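(* Let $\mu:\mathfrak{h}\to\mathfrak{g}$ be a crossed module of finite-dimensional complex Lie algebras and let $t\in\mathbb{C}$. The deformed Lie algebra $\mathfrak{h}\times^{\mu}_t\mathfrak{g}$ is solvable if and only if $\mathfrak{g}$ is solvable.
   Context: A crossed module of Lie algebras is a Lie algebra homomorphism $\mu:\mathfrak{h}\to\mathfrak{g}$ together with an action of $\mathfrak{g}$ on $\mathfrak{h}$ by derivations, written $g\cdot h$, such that for all $g\in\mathfrak{g}$ and $h,h'\in\mathfrak{h}$: (a) $\mu(g\cdot h)=[g,\mu(h)]$, and (b) $\mu(h)\cdot h'=[h,h']$. The deformed Lie algebra $\mathfrak{h}\times^{\mu}_t\mathfrak{g}$ is the vector space $\mathfrak{h}\oplus\mathfrak{g}$ with bracket $[(h,g),(h',g')]_t=(g\cdot h'-g'\cdot h,[g,g']+t\mu([h,h']))$. *)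

theory Defs
  imports "HOL-Analysis.Product_Vector"
begin

locale lie_algebra = vector_space scale
  for scale :: "'f::field \<Rightarrow> 'a::ab_group_add \<Rightarrow> 'a" +
  fixes bracket :: "'a \<Rightarrow> 'a \<Rightarrow> 'a"
  assumes linear_bracket_right: "Vector_Spaces.linear scale scale (\<lambda>y. bracket x y)"
    and linear_bracket_left: "Vector_Spaces.linear scale scale (\<lambda>x. bracket x y)"
    and bracket_self: "bracket x x = 0"
    and jacobi: "bracket x (bracket y z) + bracket y (bracket z x) + bracket z (bracket x y) = 0"
begin

primrec derived_series :: "nat \<Rightarrow> 'a set" where
  "derived_series 0 = UNIV"
| "derived_series (Suc n) =
     span {bracket x y | x y. x \<in> derived_series n \<and> y \<in> derived_series n}"

definition solvable :: bool where
  "solvable \<longleftrightarrow> (\<exists>n. derived_series n = {0})"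

lemma bracket_simps:
  "bracket x (y + z) = bracket x y + bracket x z"
  "bracket (x + y) z = bracket x z + bracket y z"
  "bracket x (scale c y) = scale c (bracket x y)"
  "bracket (scale c x) y = scale c (bracket x y)"
  "bracket x (y - z) = bracket x y - bracket x z"
  "bracket (x - y) z = bracket x z - bracket y z"
proof -
  interpret R: Vector_Spaces.linear scale scale "\<lambda>y. bracket x y" for x
    by (rule linear_bracket_right)
  interpret L: Vector_Spaces.linear scale scale "\<lambda>x. bracket x y" for y
    by (rule linear_bracket_left)
  show
    "bracket x (y + z) = bracket x y + bracket x z"
    "bracket (x + y) z = bracket x z + bracket y z"
    "bracket x (scale c y) = scale c (bracket x y)"
    "bracket (scale c x) y = scale c (bracket x y)"
    "bracket x (y - z) = bracket x y - bracket x z"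
    "bracket (x - y) z = bracket x z - bracket y z"
    by (rule R.add L.add R.scale L.scale R.diff L.diff)+
qed

lemma bracket_skew: "bracket x y = - bracket y x"
proof -
  have "bracket x y + bracket y x = 0"
    using bracket_self[of "x + y", unfolded bracket_simps] by (simp add: bracket_self add.commute)
  then show ?thesis
    by (simp add: eq_neg_iff_add_eq_0)
qed

end

locale lie_algebra_hom =
  dom: lie_algebra scale1 bracket1 + cod: lie_algebra scale2 bracket2 +
  lin: Vector_Spaces.linear scale1 scale2 f
  for scale1 :: "'f::field \<Rightarrow> 'a::ab_group_add \<Rightarrow> 'a"
    and bracket1 :: "'a \<Rightarrow> 'a \<Rightarrow> 'a"
    and scale2 :: "'f \<Rightarrow> 'b::ab_group_add \<Rightarrow> 'b"
    and bracket2 :: "'b \<Rightarrow> 'b \<Rightarrow> 'b"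
    and f :: "'a \<Rightarrow> 'b" +
  assumes hom_bracket: "f (bracket1 x y) = bracket2 (f x) (f y)"

text \<open>The assumptions say that \<open>g \<mapsto> act g\<close> is a Lie algebra homomorphism into the
  derivations of the second Lie algebra.\<close>

locale lie_derivation_action =
  alg: lie_algebra scale_g bracket_g + tgt: lie_algebra scale_h bracket_h
  for scale_g :: "'f::field \<Rightarrow> 'g::ab_group_add \<Rightarrow> 'g"
    and bracket_g :: "'g \<Rightarrow> 'g \<Rightarrow> 'g"
    and scale_h :: "'f \<Rightarrow> 'h::ab_group_add \<Rightarrow> 'h"
    and bracket_h :: "'h \<Rightarrow> 'h \<Rightarrow> 'h" +
  fixes act :: "'g \<Rightarrow> 'h \<Rightarrow> 'h"
  assumes linear_act_right: "Vector_Spaces.linear scale_h scale_h (\<lambda>h. act g h)"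
    and linear_act_left: "Vector_Spaces.linear scale_g scale_h (\<lambda>g. act g h)"
    and act_bracket: "act (bracket_g g g') h = act g (act g' h) - act g' (act g h)"
    and act_derivation:
      "act g (bracket_h h h') = bracket_h (act g h) h' + bracket_h h (act g h')"
begin

lemma act_simps:
  "act g (h + h') = act g h + act g h'"
  "act (g + g') h = act g h + act g' h"
  "act g (scale_h c h) = scale_h c (act g h)"
  "act (scale_g c g) h = scale_h c (act g h)"
  "act g (h - h') = act g h - act g h'"
proof -
  interpret R: Vector_Spaces.linear scale_h scale_h "\<lambda>h. act g h" for g
    by (rule linear_act_right)
  interpret L: Vector_Spaces.linear scale_g scale_h "\<lambda>g. act g h" for h
    by (rule linear_act_left)
  show
    "act g (h + h') = act g h + act g h'"
    "act (g + g') h = act g h + act g' h"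
    "act g (scale_h c h) = scale_h c (act g h)"
    "act (scale_g c g) h = scale_h c (act g h)"
    "act g (h - h') = act g h - act g h'"
    by (rule R.add L.add R.scale L.scale R.diff)+
qed

end

locale crossed_module =
  lie_algebra_hom scale_h bracket_h scale_g bracket_g \<mu> +
  lie_derivation_action scale_g bracket_g scale_h bracket_h act
  for scale_h :: "'f::field \<Rightarrow> 'h::ab_group_add \<Rightarrow> 'h"
    and bracket_h :: "'h \<Rightarrow> 'h \<Rightarrow> 'h"
    and scale_g :: "'f \<Rightarrow> 'g::ab_group_add \<Rightarrow> 'g"
    and bracket_g :: "'g \<Rightarrow> 'g \<Rightarrow> 'g"
    and \<mu> :: "'h \<Rightarrow> 'g"
    and act :: "'g \<Rightarrow> 'h \<Rightarrow> 'h" +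
  assumes equivariant: "\<mu> (act g h) = bracket_g g (\<mu> h)"
    and peiffer: "act (\<mu> h) h' = bracket_h h h'"
begin

definition deformed_scale :: "'f \<Rightarrow> 'h \<times> 'g \<Rightarrow> 'h \<times> 'g" where
  "deformed_scale = module_prod.scale scale_h scale_g"

definition deformed_bracket :: "'f \<Rightarrow> 'h \<times> 'g \<Rightarrow> 'h \<times> 'g \<Rightarrow> 'h \<times> 'g" where
  "deformed_bracket t = (\<lambda>(h, g) (h', g').
     (act g h' - act g' h, bracket_g g g' + scale_g t (\<mu> (bracket_h h h'))))"

lemma lie_algebra_deformed: "lie_algebra deformed_scale (deformed_bracket t)"
proof -
  interpret P: vector_space_prod scale_h scale_g ..
  interpret D: vector_space deformed_scale
    unfolding deformed_scale_def by (rule P.p.vector_space_axioms)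
  have sc: "deformed_scale c (h, g) = (scale_h c h, scale_g c g)" for c h g
    by (simp add: deformed_scale_def P.scale_prod)
  have br: "deformed_bracket t (h, g) (h', g') =
      (act g h' - act g' h, bracket_g g g' + scale_g t (\<mu> (bracket_h h h')))" for h g h' g'
    by (simp add: deformed_bracket_def)
  note simps = sc br act_simps dom.bracket_simps cod.bracket_simps lin.add lin.diff lin.scale
    dom.scale_right_distrib dom.scale_right_diff_distrib
    cod.scale_right_distrib cod.scale_right_diff_distrib
  show ?thesis
  proof
    fix x y z w :: "'h \<times> 'g" and c :: 'f
    obtain hx gx where x: "x = (hx, gx)" by (cases x)
    obtain hy gy where y: "y = (hy, gy)" by (cases y)
    obtain hz gz where z: "z = (hz, gz)" by (cases z)
    show "deformed_bracket t x (y + z) = deformed_bracket t x y + deformed_bracket t x z"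
      by (simp add: x y z simps)
    show "deformed_bracket t (x + y) z = deformed_bracket t x z + deformed_bracket t y z"
      by (simp add: x y z simps)
    show "deformed_bracket t x (deformed_scale c y) = deformed_scale c (deformed_bracket t x y)"
      by (simp add: x y simps mult.commute)
    show "deformed_bracket t (deformed_scale c x) y = deformed_scale c (deformed_bracket t x y)"
      by (simp add: x y simps mult.commute)
    show "deformed_bracket t x x = 0"
      by (simp add: x br dom.bracket_self cod.bracket_self lin.zero zero_prod_def)
    have h: "act gx (act gy hz - act gz hy) - act (bracket_g gy gz + scale_g t (\<mu> (bracket_h hy hz))) hx
      + (act gy (act gz hx - act gx hz) - act (bracket_g gz gx + scale_g t (\<mu> (bracket_h hz hx))) hy)
      + (act gz (act gx hy - act gy hx) - act (bracket_g gx gy + scale_g t (\<mu> (bracket_h hx hy))) hz)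
      = 0" (is "?h = 0")
    proof -
      have "?h = scale_h t (bracket_h hx (bracket_h hy hz) + bracket_h hy (bracket_h hz hx)
          + bracket_h hz (bracket_h hx hy))"
        by (simp add: simps act_bracket peiffer dom.bracket_skew[of "bracket_h _ _"])
      then show ?thesis
        by (simp add: dom.jacobi)
    qed
    have g: "bracket_g gx (bracket_g gy gz + scale_g t (\<mu> (bracket_h hy hz)))
        + scale_g t (\<mu> (bracket_h hx (act gy hz - act gz hy)))
      + (bracket_g gy (bracket_g gz gx + scale_g t (\<mu> (bracket_h hz hx)))
        + scale_g t (\<mu> (bracket_h hy (act gz hx - act gx hz))))
      + (bracket_g gz (bracket_g gx gy + scale_g t (\<mu> (bracket_h hx hy)))
        + scale_g t (\<mu> (bracket_h hz (act gx hy - act gy hx))))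
      = 0" (is "?g = 0")
    proof -
      have "?g = bracket_g gx (bracket_g gy gz) + bracket_g gy (bracket_g gz gx)
          + bracket_g gz (bracket_g gx gy)"
        by (simp add: simps equivariant[symmetric] act_derivation lin.neg
            dom.bracket_skew[of "act _ _"])
      then show ?thesis
        by (simp add: cod.jacobi)
    qed
    show "deformed_bracket t x (deformed_bracket t y z) + deformed_bracket t y (deformed_bracket t z x)
        + deformed_bracket t z (deformed_bracket t x y) = 0"
      using h g by (simp add: x y z br zero_prod_def)
  qed
qed

end

end

theory Submission
  imports Defs
begin

text \<open>Over \<open>\<complex>\<close> the parameter has a square root \<open>s\<close>, so that \<open>t = s\<^sup>2\<close>. Equivariance and
  \<open>t = s\<^sup>2\<close> are exactly what makes \<open>\<phi>\<^sub>s (h, g) = g + s \<mu> h\<close> a homomorphism from the deformed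
  Lie algebra onto \<open>\<gg>\<close>, because the term \<open>s\<^sup>2 [\<mu> h, \<mu> h']\<close> absorbs the deformation
  \<open>t \<mu> [h, h']\<close>. Hence \<open>\<gg>\<close> is a quotient of the deformed algebra and inherits solvability
  from it.

  For the converse, \<open>-s\<close> is also a square root of \<open>t\<close>, so both \<open>\<phi>\<^sub>s\<close> and \<open>\<phi>\<^sub>-\<^sub>s\<close> send the
  \<open>n\<close>-th term of the derived series into that of \<open>\<gg>\<close>. If the latter vanishes, then the former
  lies in the intersection of the two kernels. There \<open>g = 0\<close> and \<open>s \<mu> h = 0\<close>, since
  \<open>2\<close> is invertible. Such elements commute: their action terms vanish with \<open>g\<close>, and the
  deformation term with \<open>t \<mu> h = s (s \<mu> h)\<close>. So the derived series of the deformed algebra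
  reaches \<open>0\<close> at most one step later.\<close>

lemma (in lie_algebra) zero_in_derived_series: "0 \<in> derived_series n"
  by (cases n) (simp_all add: span_zero)

lemma (in lie_algebra) solvableI: "derived_series n \<subseteq> {0} \<Longrightarrow> solvable"
  unfolding solvable_def using zero_in_derived_series by blast

context lie_algebra_hom
begin

lemma derived_series_image_subset: "f ` dom.derived_series n \<subseteq> cod.derived_series n"
proof (induction n)
  case (Suc n)
  let ?A = "{bracket1 x y |x y. x \<in> dom.derived_series n \<and> y \<in> dom.derived_series n}"
  have "f ` ?A \<subseteq> {bracket2 x y |x y. x \<in> cod.derived_series n \<and> y \<in> cod.derived_series n}"
    using Suc.IH by (auto simp: hom_bracket) blast
  then have "cod.span (f ` ?A) \<subseteq> cod.derived_series (Suc n)"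
    by (simp add: cod.span_mono)
  then show ?case
    by (simp add: lin.span_image)
qed simp

lemma derived_series_subset_image:
  assumes "surj f"
  shows "cod.derived_series n \<subseteq> f ` dom.derived_series n"
proof (induction n)
  case 0
  then show ?case using assms by simp
next
  case (Suc n)
  let ?A = "{bracket1 x y |x y. x \<in> dom.derived_series n \<and> y \<in> dom.derived_series n}"
  have "{bracket2 x y |x y. x \<in> cod.derived_series n \<and> y \<in> cod.derived_series n} \<subseteq> f ` ?A"
  proof
    fix z
    assume "z \<in> {bracket2 x y |x y. x \<in> cod.derived_series n \<and> y \<in> cod.derived_series n}"
    then obtain x y where "x \<in> cod.derived_series n" "y \<in> cod.derived_series n"
      and z: "z = bracket2 x y"
      by blast
    with Suc.IH obtain a b where "a \<in> dom.derived_series n" "b \<in> dom.derived_series n"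
      and "x = f a" "y = f b"
      by blast
    with z show "z \<in> f ` ?A"
      by (auto simp: hom_bracket[symmetric])
  qed
  then have "cod.derived_series (Suc n) \<subseteq> cod.span (f ` ?A)"
    by (simp add: cod.span_mono)
  then show ?case
    by (simp add: lin.span_image)
qed

lemma solvable_surj_image:
  assumes "surj f" and "dom.solvable"
  shows "cod.solvable"
proof -
  from \<open>dom.solvable\<close> obtain n where "dom.derived_series n = {0}"
    unfolding dom.solvable_def by blast
  with derived_series_subset_image[OF \<open>surj f\<close>, of n] have "cod.derived_series n \<subseteq> {0}"
    by (simp add: lin.zero)
  then show ?thesis
    by (rule cod.solvableI)
qed

end

context crossed_module
begin

definition untwist :: "'f \<Rightarrow> 'h \<times> 'g \<Rightarrow> 'g" where
  "untwist s = (\<lambda>(h, g). g + scale_g s (\<mu> h))"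

lemma surj_untwist: "surj (untwist s)"
proof
  show "UNIV \<subseteq> range (untwist s)"
  proof
    fix g
    have "g = untwist s (0, g)"
      by (simp add: untwist_def lin.zero)
    then show "g \<in> range (untwist s)"
      by (rule range_eqI)
  qed
qed simp

text \<open>Both mixed terms \<open>s [g, \<mu> h']\<close> and \<open>s [\<mu> h, g']\<close> of the bracket in \<open>\<gg>\<close> come from the
  action by equivariance; the remaining quadratic term forces the parameter \<open>s * s\<close>.\<close>

lemma lie_algebra_hom_untwist:
  "lie_algebra_hom deformed_scale (deformed_bracket (s * s)) scale_g bracket_g (untwist s)"
proof -
  interpret P: vector_space_prod scale_h scale_g ..
  interpret D: lie_algebra deformed_scale "deformed_bracket (s * s)"
    by (rule lie_algebra_deformed)
  have sc: "deformed_scale c (h, g) = (scale_h c h, scale_g c g)" for c h g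
    by (simp add: deformed_scale_def P.scale_prod)
  note simps = sc untwist_def deformed_bracket_def lin.add lin.diff lin.scale
    cod.scale_right_distrib cod.scale_right_diff_distrib cod.bracket_simps
    hom_bracket equivariant
  show ?thesis
  proof
    fix x y :: "'h \<times> 'g" and c :: 'f
    obtain h g where x: "x = (h, g)" by (cases x)
    obtain h' g' where y: "y = (h', g')" by (cases y)
    show "untwist s (x + y) = untwist s x + untwist s y"
      by (simp add: x y simps)
    show "untwist s (deformed_scale c x) = scale_g c (untwist s x)"
      by (simp add: x simps mult.commute)
    show "untwist s (deformed_bracket (s * s) x y) = bracket_g (untwist s x) (untwist s y)"
      by (simp add: x y simps cod.bracket_skew[of g' "\<mu> h"])
  qed
qed

lemma untwist_kernels_intersection:
  assumes "(2::'f) \<noteq> 0" and "untwist s (h, g) = 0" and "untwist (- s) (h, g) = 0"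
  shows "g = 0" and "scale_g s (\<mu> h) = 0"
proof -
  have plus: "g + scale_g s (\<mu> h) = 0" and minus: "g = scale_g s (\<mu> h)"
    using assms(2,3) by (simp_all add: untwist_def)
  then have "scale_g 2 g = 0"
    using cod.scale_left_distrib[of 1 1 g] by simp
  then show "g = 0"
    using \<open>(2::'f) \<noteq> 0\<close> by simp
  then show "scale_g s (\<mu> h) = 0"
    using minus by simp
qed

text \<open>Having both projections is what avoids an extension argument: each kernel separately is a
  rescaled copy of \<open>\<hh>\<close> when \<open>s \<noteq> 0\<close>, whereas their intersection is abelian.\<close>

lemma solvable_deformed:
  assumes "(2::'f) \<noteq> 0" and "cod.solvable"
  shows "lie_algebra.solvable deformed_scale (deformed_bracket (s * s))"
proof -
  interpret D: lie_algebra deformed_scale "deformed_bracket (s * s)"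
    by (rule lie_algebra_deformed)
  interpret plus: lie_algebra_hom deformed_scale "deformed_bracket (s * s)" scale_g bracket_g
      "untwist s"
    by (rule lie_algebra_hom_untwist)
  interpret minus: lie_algebra_hom deformed_scale "deformed_bracket (s * s)" scale_g bracket_g
      "untwist (- s)"
    using lie_algebra_hom_untwist[of "- s"] by simp
  from \<open>cod.solvable\<close> obtain n where n: "cod.derived_series n = {0}"
    unfolding cod.solvable_def by blast
  have kernel: "g = 0 \<and> scale_g s (\<mu> h) = 0" if "(h, g) \<in> D.derived_series n" for h g
  proof -
    have "untwist s (h, g) = 0" "untwist (- s) (h, g) = 0"
      using that plus.derived_series_image_subset[of n] minus.derived_series_image_subset[of n] n
      by blast+
    then show ?thesis
      using untwist_kernels_intersection[OF assms(1)] by blast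
  qed
  \<comment> \<open>The intersection of the two kernels is abelian.\<close>
  have "deformed_bracket (s * s) x y = 0"
    if "x \<in> D.derived_series n" "y \<in> D.derived_series n" for x y
  proof -
    obtain h g where x: "x = (h, g)" by (cases x)
    obtain h' g' where y: "y = (h', g')" by (cases y)
    have "g = 0" "g' = 0" and h: "scale_g s (\<mu> h) = 0"
      using kernel that x y by blast+
    have "act 0 k = 0" for k
      using act_simps(4)[of 0 0 k] by simp
    moreover have "bracket_g 0 0 = 0"
      by (rule cod.bracket_self)
    moreover have "scale_g (s * s) (\<mu> (bracket_h h h')) =
        scale_g s (bracket_g (scale_g s (\<mu> h)) (\<mu> h'))"
      by (simp add: hom_bracket cod.bracket_simps)
    moreover have "bracket_g 0 k = 0" for k
      using cod.bracket_simps(4)[of 0 0 k] by simp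
    ultimately show ?thesis
      by (simp add: x y deformed_bracket_def \<open>g = 0\<close> \<open>g' = 0\<close> h zero_prod_def)
  qed
  then have "D.derived_series (Suc n) \<subseteq> D.span {0}"
    unfolding D.derived_series.simps by (intro D.span_mono) blast
  then show ?thesis
    by (intro D.solvableI[of "Suc n"]) simp
qed

lemma solvable_deformed_iff:
  assumes "(2::'f) \<noteq> 0"
  shows "lie_algebra.solvable deformed_scale (deformed_bracket (s * s)) \<longleftrightarrow> cod.solvable"
  using solvable_deformed[OF assms]
    lie_algebra_hom.solvable_surj_image[OF lie_algebra_hom_untwist surj_untwist]
  by blast

end

theorem corollary4p18:
  fixes scale_h :: "complex \<Rightarrow> 'h::ab_group_add \<Rightarrow> 'h"
    and bracket_h :: "'h \<Rightarrow> 'h \<Rightarrow> 'h"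
    and scale_g :: "complex \<Rightarrow> 'g::ab_group_add \<Rightarrow> 'g"
    and bracket_g :: "'g \<Rightarrow> 'g \<Rightarrow> 'g"
    and \<mu> :: "'h \<Rightarrow> 'g"
    and act :: "'g \<Rightarrow> 'h \<Rightarrow> 'h"
    and t :: complex
  assumes "crossed_module scale_h bracket_h scale_g bracket_g \<mu> act"
    and "\<exists>B. finite_dimensional_vector_space scale_h B"
    and "\<exists>B. finite_dimensional_vector_space scale_g B"
  shows "lie_algebra.solvable
           (crossed_module.deformed_scale scale_h scale_g)
           (crossed_module.deformed_bracket bracket_h scale_g bracket_g \<mu> act t)
         \<longleftrightarrow> lie_algebra.solvable scale_g bracket_g"
proof -
  have "csqrt t * csqrt t = t"
    by (metis power2_csqrt power2_eq_square)
  then show ?thesis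
    using crossed_module.solvable_deformed_iff[OF assms(1), of "csqrt t"] by simp
qed

end
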